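(* A sequence $(x_n)_{n=1}^{\infty}$ on $[0,1]$ or on $\mathbb{T}=\mathbb{R}/\mathbb{Z}$ is uniformly distributed if and only if $$ \lim_{N \rightarrow \infty} \frac{1}{N^2} \sum_{m,n = 1}^{N} \theta_{1}(x_n - x_m) = 1.$$
   Context: $\mathbb{T}$ is the one-dimensional torus normalized to have length $1$. For $t>0$, the Jacobi $\theta$-function is $\theta_t(x) = 1 + 2 \sum_{n=1}^{\infty} e^{-4 \pi^2 n^2 t}\cos(2 \pi n x)$. Since $\theta_t$ is even and $1$-periodic, no distinction is made between points of $[0,1]$ and points of $\mathbb{T}$. A sequence is uniformly distributed if for every interval $J$ (an arc in the case of $\mathbb{T}$), $\lim_{N\to\infty}\frac1N\#\{1\le i\le N: x_i\in J\}=|J|$, where $|J|$ is the length of $J$; when a sequence on $[0,1]$ is considered, its uniform distribution may be understood via its image in $\mathbb{T}$ (endpoints $0$ and $1$ identified). *)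

theory Defs
  imports "HOL-Analysis.Analysis"
begin

quotient_type torus = real / "\<lambda>x y :: real. x - y \<in> \<int>"
proof (rule equivpI)
  show "reflp (\<lambda>x y :: real. x - y \<in> \<int>)"
    by (simp add: reflp_def)
  show "symp (\<lambda>x y :: real. x - y \<in> \<int>)"
  proof (rule sympI)
    fix x y :: real
    assume "x - y \<in> \<int>"
    then have "- (x - y) \<in> \<int>" by (rule Ints_minus)
    then show "y - x \<in> \<int>" by simp
  qed
  show "transp (\<lambda>x y :: real. x - y \<in> \<int>)"
  proof (rule transpI)
    fix x y z :: real
    assume "x - y \<in> \<int>" "y - z \<in> \<int>"
    then have "(x - y) + (y - z) \<in> \<int>" by (rule Ints_add)
    then show "x - z \<in> \<int>" by simp
  qed
qed

lift_definition to_torus :: "real \<Rightarrow> torus" is "\<lambda>x. x" .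

instantiation torus :: ab_group_add
begin

lift_definition zero_torus :: torus is 0 .

lift_definition plus_torus :: "torus \<Rightarrow> torus \<Rightarrow> torus" is "(+)"
proof -
  fix a b c d :: real
  assume "a - b \<in> \<int>" "c - d \<in> \<int>"
  then have "(a - b) + (c - d) \<in> \<int>" by (rule Ints_add)
  then show "(a + c) - (b + d) \<in> \<int>" by (simp add: algebra_simps)
qed

lift_definition uminus_torus :: "torus \<Rightarrow> torus" is uminus
proof -
  fix a b :: real
  assume "a - b \<in> \<int>"
  then have "- (a - b) \<in> \<int>" by (rule Ints_minus)
  then show "- a - - b \<in> \<int>" by simp
qed

lift_definition minus_torus :: "torus \<Rightarrow> torus \<Rightarrow> torus" is "(-)"
proof -
  fix a b c d :: real
  assume "a - b \<in> \<int>" "c - d \<in> \<int>"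
  then have "(a - b) - (c - d) \<in> \<int>" by (rule Ints_diff)
  then show "(a - c) - (b - d) \<in> \<int>" by (simp add: algebra_simps)
qed

instance
  by standard (transfer; simp add: algebra_simps)+

end

definition jacobi_theta :: "real \<Rightarrow> real \<Rightarrow> real" where
  "jacobi_theta t x =
     1 + 2 * (\<Sum>n. exp (- 4 * pi\<^sup>2 * (real (Suc n))\<^sup>2 * t) * cos (2 * pi * real (Suc n) * x))"

lemma summable_jacobi_theta:
  assumes "t > 0"
  shows "summable (\<lambda>n. exp (- 4 * pi\<^sup>2 * (real (Suc n))\<^sup>2 * t) * cos (2 * pi * real (Suc n) * x))"
proof (rule summable_comparison_test)
  let ?q = "exp (- 4 * pi\<^sup>2 * t)"
  have "?q < 1" using assms by simp
  then show "summable (\<lambda>n. ?q ^ n)" by (intro summable_geometric) simp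
  have "norm (exp (- 4 * pi\<^sup>2 * (real (Suc n))\<^sup>2 * t) * cos (2 * pi * real (Suc n) * x)) \<le> ?q ^ n" for n
  proof -
    have "real n * 1 \<le> real (Suc n) * real (Suc n)"
      by (intro mult_mono) auto
    then have "(4 * pi\<^sup>2 * t) * real n \<le> (4 * pi\<^sup>2 * t) * (real (Suc n))\<^sup>2"
      using assms by (intro mult_left_mono) (auto simp: power2_eq_square)
    then have "exp (- 4 * pi\<^sup>2 * (real (Suc n))\<^sup>2 * t) \<le> exp (real n * (- 4 * pi\<^sup>2 * t))"
      by (simp add: mult_ac)
    also have "\<dots> = ?q ^ n" by (rule exp_of_nat_mult)
    finally have le: "exp (- 4 * pi\<^sup>2 * (real (Suc n))\<^sup>2 * t) \<le> ?q ^ n" .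
    have "norm (exp (- 4 * pi\<^sup>2 * (real (Suc n))\<^sup>2 * t) * cos (2 * pi * real (Suc n) * x))
        \<le> exp (- 4 * pi\<^sup>2 * (real (Suc n))\<^sup>2 * t) * 1"
      unfolding norm_mult by (intro mult_mono) (auto intro: abs_cos_le_one)
    with le show ?thesis by linarith
  qed
  then show "\<exists>N. \<forall>n\<ge>N. norm (exp (- 4 * pi\<^sup>2 * (real (Suc n))\<^sup>2 * t) * cos (2 * pi * real (Suc n) * x)) \<le> ?q ^ n"
    by blast
qed

lemma jacobi_theta_periodic:
  assumes "x - y \<in> \<int>"
  shows "jacobi_theta t x = jacobi_theta t y"
proof -
  from assms obtain k :: int where "x - y = of_int k"
    by (rule Ints_cases)
  then have k: "x = y + of_int k" by linarith
  have "cos (2 * pi * real (Suc n) * x) = cos (2 * pi * real (Suc n) * y)" for n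
  proof -
    have "2 * pi * real (Suc n) * x
        = 2 * pi * real (Suc n) * y + 2 * pi * of_int (int (Suc n) * k)"
      unfolding k by (simp add: algebra_simps)
    then show ?thesis
      by (simp only: cos_add cos_int_2pin sin_int_2pin mult_1_right mult_zero_right diff_zero)
  qed
  then show ?thesis by (simp only: jacobi_theta_def)
qed

lift_definition torus_theta :: "real \<Rightarrow> torus \<Rightarrow> real" is jacobi_theta
  by (rule jacobi_theta_periodic)

text \<open>Sequences are indexed from 1; the value at index 0 plays no role.\<close>

definition visits :: "(nat \<Rightarrow> 'a) \<Rightarrow> 'a set \<Rightarrow> nat \<Rightarrow> nat" where
  "visits x J N = card {i \<in> {1..N}. x i \<in> J}"

definition uniformly_distributed_interval :: "(nat \<Rightarrow> real) \<Rightarrow> bool" where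
  "uniformly_distributed_interval x \<longleftrightarrow>
     (\<forall>J. is_interval J \<and> J \<subseteq> {0..1} \<longrightarrow>
        (\<lambda>N. real (visits x J N) / real N) \<longlonglongrightarrow> measure lborel J)"

text \<open>
  An arc is the image of a bounded real interval of length at most 1, and its length is
  that of the interval.  Boundedness is required separately because \<^const>\<open>measure\<close>
  assigns 0 to sets of infinite measure.
\<close>

definition uniformly_distributed_torus :: "(nat \<Rightarrow> torus) \<Rightarrow> bool" where
  "uniformly_distributed_torus x \<longleftrightarrow>
     (\<forall>I. is_interval I \<and> bounded I \<and> measure lborel I \<le> 1 \<longrightarrow>
        (\<lambda>N. real (visits x (to_torus ` I) N) / real N) \<longlonglongrightarrow> measure lborel I)"

end

theory Submission
  imports Defs
begin

text \<open>
  Expanding the theta function turns the energy into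
  \<open>1 + 2 * (\<Sum>k\<ge>1. c\<^sub>k * \<bar>W\<^sub>N(k)\<bar>\<^sup>2)\<close> with \<open>c\<^sub>k = exp (- 4 \<pi>\<^sup>2 k\<^sup>2) > 0\<close> summable and
  \<open>W\<^sub>N(k)\<close> the normalised Weyl sum, which is bounded by 1.  Hence it tends to 1 iff every
  Weyl sum tends to 0, and the theorem reduces to Weyl's criterion.
  For the criterion, trigonometric polynomials are dense among the continuous functions on the
  circle (Stone-Weierstrass) and a continuous majorant gives the upper bound for closed arcs;
  the lower bound is the upper bound for the complementary arc.  Conversely, \<open>e(kt)\<close> is uniformly
  close to its step function on \<open>M\<close> equal cells, whose mean tends to a vanishing geometric sum.
  On \<open>[0,1]\<close>, passing to the torus only affects visits to the endpoints, which have frequency 0.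
\<close>

section \<open>The theta energy and Weyl sums\<close>

text \<open>Real representatives serve both settings, since each sum depends on \<open>u\<close>
  only modulo 1. Positive frequencies suffice because \<open>-k\<close> gives the conjugate
  sum.\<close>

definition weyl_sums_vanish :: "(nat \<Rightarrow> real) \<Rightarrow> bool" where
  "weyl_sums_vanish u \<longleftrightarrow>
     (\<forall>k::nat. k > 0 \<longrightarrow> (\<lambda>N. (\<Sum>n=1..N. cis (2 * pi * real k * u n)) / of_nat N) \<longlonglongrightarrow> 0)"

text \<open>The squared modulus is the sum times its conjugate. Multiplying out gives
  \<open>cis (a n - a m)\<close> over all pairs, and the real part is the cosine sum.\<close>

lemma double_sum_cos_diff:
  fixes a :: "'a \<Rightarrow> real"
  shows "(\<Sum>m\<in>A. \<Sum>n\<in>A. cos (a n - a m)) = (cmod (\<Sum>n\<in>A. cis (a n)))\<^sup>2"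
proof -
  have "of_real ((cmod (\<Sum>n\<in>A. cis (a n)))\<^sup>2) = (\<Sum>n\<in>A. cis (a n)) * cnj (\<Sum>n\<in>A. cis (a n))"
    by (rule complex_norm_square)
  also have "\<dots> = cnj (\<Sum>n\<in>A. cis (a n)) * (\<Sum>n\<in>A. cis (a n))"
    by (rule mult.commute)
  also have "\<dots> = (\<Sum>m\<in>A. \<Sum>n\<in>A. cis (a n - a m))"
    by (simp add: cis_cnj sum_product cis_mult)
  finally have "(cmod (\<Sum>n\<in>A. cis (a n)))\<^sup>2 = Re (\<Sum>m\<in>A. \<Sum>n\<in>A. cis (a n - a m))"
    by (metis Re_complex_of_real)
  then show ?thesis by simp
qed

text \<open>Finite sums commute with the convergent series, and for each frequency the double cosine
  sum is a squared modulus. The constant term of theta contributes \<open>N * N\<close>, which the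
  normalisation turns into 1.\<close>

lemma theta_energy_eq:
  assumes "t > 0" "N > 0"
  shows "1 / (real N)\<^sup>2 * (\<Sum>m=1..N. \<Sum>n=1..N. jacobi_theta t (u n - u m))
    = 1 + 2 * (\<Sum>k. exp (- 4 * pi\<^sup>2 * (real (Suc k))\<^sup>2 * t) *
        (cmod ((\<Sum>n=1..N. cis (2 * pi * real (Suc k) * u n)) / of_nat N))\<^sup>2)"
proof -
  define c where "c k = exp (- 4 * pi\<^sup>2 * (real (Suc k))\<^sup>2 * t)" for k
  define a where "a k n = 2 * pi * real (Suc k) * u n" for k n
  have sm: "summable (\<lambda>k. c k * cos (a k n - a k m))" for n m
    using summable_jacobi_theta[OF assms(1), of "u n - u m"]
    by (simp add: c_def a_def algebra_simps)
  have th: "jacobi_theta t (u n - u m) = 1 + 2 * (\<Sum>k. c k * cos (a k n - a k m))" for n m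
    by (simp add: jacobi_theta_def c_def a_def algebra_simps)
  have inner: "(\<Sum>n=1..N. \<Sum>k. c k * cos (a k n - a k m)) = (\<Sum>k. \<Sum>n=1..N. c k * cos (a k n - a k m))" for m
    by (rule suminf_sum[symmetric]) (rule sm)
  have "(\<Sum>m=1..N. \<Sum>n=1..N. \<Sum>k. c k * cos (a k n - a k m))
     = (\<Sum>k. \<Sum>m=1..N. \<Sum>n=1..N. c k * cos (a k n - a k m))"
    unfolding inner by (rule suminf_sum[symmetric]) (intro summable_sum sm)
  also have "\<dots> = (\<Sum>k. c k * (cmod (\<Sum>n=1..N. cis (a k n)))\<^sup>2)"
    by (simp add: sum_distrib_left[symmetric] double_sum_cos_diff)
  finally have eq: "(\<Sum>m=1..N. \<Sum>n=1..N. jacobi_theta t (u n - u m))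
     = (real N)\<^sup>2 + 2 * (\<Sum>k. c k * (cmod (\<Sum>n=1..N. cis (a k n)))\<^sup>2)"
    by (simp add: th sum.distrib sum_distrib_left[symmetric] power2_eq_square)
  have "summable (\<lambda>k. \<Sum>m=1..N. \<Sum>n=1..N. c k * cos (a k n - a k m))"
    by (intro summable_sum sm)
  then have sm2: "summable (\<lambda>k. c k * (cmod (\<Sum>n=1..N. cis (a k n)))\<^sup>2)"
    by (simp add: sum_distrib_left[symmetric] double_sum_cos_diff)
  have "(\<Sum>k. c k * (cmod ((\<Sum>n=1..N. cis (a k n)) / of_nat N))\<^sup>2)
    = (\<Sum>k. c k * (cmod (\<Sum>n=1..N. cis (a k n)))\<^sup>2) / (real N)\<^sup>2"
    using sm2 by (simp add: norm_divide power_divide suminf_divide)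
  then show ?thesis
    using assms(2) unfolding eq by (simp add: c_def a_def field_simps)
qed

text \<open>At \<open>N = 0\<close> the quotient is 0 by convention, so the bound is uniform in
  \<open>N\<close>, as a dominating series requires.\<close>

lemma norm_mean_cis_le_1: "cmod ((\<Sum>n=1..N. cis (a n)) / of_nat N) \<le> 1"
proof -
  have "cmod (\<Sum>n=1..N. cis (a n)) \<le> real N"
    using norm_sum[of "\<lambda>n. cis (a n)" "{1..N}"] by simp
  then show ?thesis by (simp add: norm_divide divide_le_eq)
qed

text \<open>All weights are positive, so each term is at most the whole series and tends to 0 with
  it. Conversely the weights are a summable majorant, and Tannery's theorem moves the limit inside
  the series.\<close>

theorem theta_energy_tendsto_1_iff:
  assumes "t > 0"
  shows "(\<lambda>N. 1 / (real N)\<^sup>2 * (\<Sum>m=1..N. \<Sum>n=1..N. jacobi_theta t (u n - u m))) \<longlonglongrightarrow> 1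
     \<longleftrightarrow> weyl_sums_vanish u"
proof -
  define c where "c k = exp (- 4 * pi\<^sup>2 * (real (Suc k))\<^sup>2 * t)" for k
  define W where "W k N = (\<Sum>n=1..N. cis (2 * pi * real (Suc k) * u n)) / of_nat N" for k N
  have W1: "cmod (W k N) \<le> 1" for k N
    unfolding W_def by (rule norm_mean_cis_le_1)
  have c0: "c k > 0" for k by (simp add: c_def)
  have sc: "summable c"
    using summable_jacobi_theta[OF assms, of 0] unfolding c_def by simp
  have b: "c k * (cmod (W k N))\<^sup>2 \<le> c k" for k N
    using mult_left_mono[of "(cmod (W k N))\<^sup>2" 1 "c k"] W1[of k N] c0[of k]
    by (simp add: power_le_one)
  have sW: "summable (\<lambda>k. c k * (cmod (W k N))\<^sup>2)" for N
    by (rule summable_comparison_test'[OF sc, of 0])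
      (use b c0 in \<open>simp add: less_imp_le\<close>)
  \<comment> \<open>The two expressions differ at \<open>N = 0\<close>, where the left one is 0 and
    the right one is 1; hence they are compared only eventually.\<close>
  have "(\<lambda>N. 1 / (real N)\<^sup>2 * (\<Sum>m=1..N. \<Sum>n=1..N. jacobi_theta t (u n - u m))) \<longlonglongrightarrow> 1
     \<longleftrightarrow> (\<lambda>N. 1 + 2 * (\<Sum>k. c k * (cmod (W k N))\<^sup>2)) \<longlonglongrightarrow> 1"
    by (rule tendsto_cong, rule eventually_mono[OF eventually_gt_at_top[of 0]])
      (simp only: theta_energy_eq[OF assms] c_def W_def)
  also have "\<dots> \<longleftrightarrow> (\<lambda>N. \<Sum>k. c k * (cmod (W k N))\<^sup>2) \<longlonglongrightarrow> 0"
  proof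
    assume "(\<lambda>N. 1 + 2 * (\<Sum>k. c k * (cmod (W k N))\<^sup>2)) \<longlonglongrightarrow> 1"
    then have "(\<lambda>N. ((1 + 2 * (\<Sum>k. c k * (cmod (W k N))\<^sup>2)) - 1) / 2) \<longlonglongrightarrow> (1 - 1) / 2"
      by (intro tendsto_intros) auto
    then show "(\<lambda>N. \<Sum>k. c k * (cmod (W k N))\<^sup>2) \<longlonglongrightarrow> 0" by simp
  next
    assume "(\<lambda>N. \<Sum>k. c k * (cmod (W k N))\<^sup>2) \<longlonglongrightarrow> 0"
    then have "(\<lambda>N. 1 + 2 * (\<Sum>k. c k * (cmod (W k N))\<^sup>2)) \<longlonglongrightarrow> 1 + 2 * 0"
      by (intro tendsto_intros)
    then show "(\<lambda>N. 1 + 2 * (\<Sum>k. c k * (cmod (W k N))\<^sup>2)) \<longlonglongrightarrow> 1" by simp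
  qed
  also have "\<dots> \<longleftrightarrow> (\<forall>k. W k \<longlonglongrightarrow> 0)"
  proof (intro iffI allI)
    fix k
    assume lim: "(\<lambda>N. \<Sum>k. c k * (cmod (W k N))\<^sup>2) \<longlonglongrightarrow> 0"
    have "c k * (cmod (W k N))\<^sup>2 \<le> (\<Sum>k. c k * (cmod (W k N))\<^sup>2)" for N
      using sum_le_suminf[OF sW[of N], of "{k}"] c0 by (simp add: less_imp_le)
    then have "(\<lambda>N. c k * (cmod (W k N))\<^sup>2) \<longlonglongrightarrow> 0"
      using c0 by (intro tendsto_sandwich[OF always_eventually always_eventually tendsto_const lim] allI)
        (simp_all add: less_imp_le)
    \<comment> \<open>Dividing by the positive weight and taking the root recovers the modulus of
      \<open>W k N\<close>.\<close>
    then have "(\<lambda>N. sqrt (c k * (cmod (W k N))\<^sup>2 / c k)) \<longlonglongrightarrow> sqrt (0 / c k)"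
      using c0[of k] by (intro tendsto_intros) auto
    then show "W k \<longlonglongrightarrow> 0"
      using c0[of k] by (simp add: tendsto_norm_zero_iff)
  next
    assume W: "\<forall>k. W k \<longlonglongrightarrow> 0"
    have "(\<lambda>N. \<Sum>k. c k * (cmod (W k N))\<^sup>2) \<longlonglongrightarrow> (\<Sum>k::nat. (0::real))"
    proof (rule tannerys_theorem[THEN conjunct2, THEN conjunct2])
      show "(\<lambda>N. c k * (cmod (W k N))\<^sup>2) \<longlonglongrightarrow> 0" for k
        using W by (auto intro!: tendsto_eq_intros)
      show "\<forall>\<^sub>F (k, N) in at_top \<times>\<^sub>F sequentially. norm (c k * (cmod (W k N))\<^sup>2) \<le> c k"
        using b c0 by (intro always_eventually) (auto simp: less_imp_le)
    qed (simp_all add: sc)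
    then show "(\<lambda>N. \<Sum>k. c k * (cmod (W k N))\<^sup>2) \<longlonglongrightarrow> 0" by simp
  qed
  also have "\<dots> \<longleftrightarrow> weyl_sums_vanish u"
    unfolding weyl_sums_vanish_def W_def gr0_conv_Suc by blast
  finally show ?thesis .
qed

section \<open>Vanishing Weyl sums give uniform distribution\<close>

text \<open>Complex coefficients and frequencies of both signs make the class closed under products
  and let it contain sine and cosine.\<close>

inductive trig_polynomial :: "(real \<Rightarrow> complex) \<Rightarrow> bool" where
  monom: "trig_polynomial (\<lambda>t. c * cis (2 * pi * of_int k * t))"
| add: "trig_polynomial f \<Longrightarrow> trig_polynomial g \<Longrightarrow> trig_polynomial (\<lambda>t. f t + g t)"

text \<open>Multiplying two monomials adds their frequencies; distributivity extends this to sums in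
  either factor.\<close>

lemma trig_polynomial_mult:
  assumes "trig_polynomial f" "trig_polynomial g"
  shows "trig_polynomial (\<lambda>t. f t * g t)"
  using assms
proof (induction f rule: trig_polynomial.induct)
  case (monom c k)
  then show ?case
  proof (induction g rule: trig_polynomial.induct)
    case (monom d l)
    have "(\<lambda>t. c * cis (2 * pi * of_int k * t) * (d * cis (2 * pi * of_int l * t)))
      = (\<lambda>t. (c * d) * cis (2 * pi * of_int (k + l) * t))"
    proof
      fix t
      have "cis (2 * pi * of_int k * t) * cis (2 * pi * of_int l * t) = cis (2 * pi * of_int (k + l) * t)"
        by (simp add: cis_mult algebra_simps)
      then show "c * cis (2 * pi * of_int k * t) * (d * cis (2 * pi * of_int l * t))
          = (c * d) * cis (2 * pi * of_int (k + l) * t)"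
        by (metis mult.assoc mult.left_commute)
    qed
    then show ?case by (simp only: trig_polynomial.monom)
  qed (simp add: distrib_left trig_polynomial.add)
qed (simp add: distrib_right trig_polynomial.add)

text \<open>Links the polynomials of Stone-Weierstrass to Weyl sums: on the circle, real linear
  functions are combinations of frequencies 1 and -1, and sums and products stay in the
  class.\<close>

lemma trig_polynomial_real_polynomial_function:
  fixes p :: "complex \<Rightarrow> real"
  assumes "real_polynomial_function p"
  shows "trig_polynomial (\<lambda>t. of_real (p (cis (2 * pi * t))))"
  using assms
proof (induction p rule: real_polynomial_function.induct)
  case (linear f)
  interpret bounded_linear f by fact
  let ?a = "of_real (f 1) :: complex" and ?b = "of_real (f \<i>) :: complex"
  \<comment> \<open>By linearity \<open>f\<close> takes the value
    \<open>f 1 * cos + f \<i> * sin\<close>; the coefficients come from Euler's formulas for cosine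
    and sine.\<close>
  have "of_real (f (cis (2 * pi * t)))
      = (?a - \<i> * ?b) / 2 * cis (2 * pi * of_int 1 * t) + (?a + \<i> * ?b) / 2 * cis (2 * pi * of_int (-1) * t)" for t
  proof -
    have "cis (2 * pi * t) = cos (2 * pi * t) *\<^sub>R 1 + sin (2 * pi * t) *\<^sub>R \<i>"
      by (simp add: complex_eq_iff)
    then have "f (cis (2 * pi * t)) = cos (2 * pi * t) * f 1 + sin (2 * pi * t) * f \<i>"
      by (simp only: add scaleR real_scaleR_def)
    then show ?thesis by (simp add: complex_eq_iff field_simps)
  qed
  then show ?case by (simp only: trig_polynomial.intros)
next
  case (const c)
  show ?case using trig_polynomial.monom[of "of_real c" 0] by simp
qed (simp_all add: trig_polynomial.add trig_polynomial_mult)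

lemma weyl_sums_vanish_int:
  assumes "weyl_sums_vanish u" "k \<noteq> (0::int)"
  shows "(\<lambda>N. (\<Sum>n=1..N. cis (2 * pi * of_int k * u n)) / of_nat N) \<longlonglongrightarrow> 0"
proof (cases "k > 0")
  case True
  then obtain m where "k = int m" "m > 0" using pos_int_cases by blast
  then show ?thesis using assms(1) by (simp add: weyl_sums_vanish_def)
next
  case False
  then obtain m where m: "k = - int m" "m > 0" using assms(2) by (metis neg_int_cases linorder_neqE_linordered_idom)
  then have "(\<lambda>N. cnj ((\<Sum>n=1..N. cis (2 * pi * real m * u n)) / of_nat N)) \<longlonglongrightarrow> cnj 0"
    using assms(1) unfolding weyl_sums_vanish_def by (intro tendsto_cnj) blast
  then show ?thesis by (simp add: m cis_cnj)
qed

text \<open>For a nonzero frequency the integral over a period and the limit of the means are both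
  0, for a constant both are that constant, and both are additive. The period may start at any
  \<open>a\<close>, to fit the arcs considered later.\<close>

lemma mean_trig_polynomial:
  assumes "trig_polynomial f" "weyl_sums_vanish u"
  shows "(\<exists>I. (f has_integral I) {a..a+1} \<and> (\<lambda>N. (\<Sum>n=1..N. f (u n)) / of_nat N) \<longlonglongrightarrow> I)"
  using assms(1)
proof induction
  case (monom c k)
  show ?case
  proof (cases "k = 0")
    case True
    have "((\<lambda>t. c) has_integral c) {a..a+1}"
      using has_integral_const_real[of c a "a+1"] by simp
    moreover have "(\<lambda>N. (\<Sum>n=1..N. c) / of_nat N) \<longlonglongrightarrow> c"
      by (rule Lim_transform_eventually[OF tendsto_const])
        (use eventually_gt_at_top[of 0] in eventually_elim, simp)
    ultimately show ?thesis using True by auto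
  next
    case False
    define w where "w = 2 * pi * real_of_int k"
    have w: "w \<noteq> 0" using False by (simp add: w_def)
    \<comment> \<open>An antiderivative of the monomial; it takes the same value at \<open>a\<close>
      and at \<open>a + 1\<close>, so the integral vanishes.\<close>
    have deriv: "((\<lambda>t. c / (\<i> * of_real w) * cis (w * t)) has_vector_derivative c * cis (w * t)) (at t within S)"
      for t S
    proof -
      have "((\<lambda>t. cis (w * t)) has_derivative (\<lambda>h. (w * h) *\<^sub>R (\<i> * cis (w * t)))) (at t within S)"
        by (rule has_derivative_cis) (auto intro!: derivative_eq_intros)
      then have "((\<lambda>t. cis (w * t)) has_vector_derivative (\<i> * of_real w * cis (w * t))) (at t within S)"
        unfolding has_vector_derivative_def by (simp add: scaleR_conv_of_real mult_ac)
      from has_vector_derivative_mult_right[OF this, of "c / (\<i> * of_real w)"]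
      show ?thesis using w by (simp add: field_simps)
    qed
    have "((\<lambda>t. c * cis (w * t)) has_integral
        (c / (\<i> * of_real w) * cis (w * (a + 1)) - c / (\<i> * of_real w) * cis (w * a))) {a..a+1}"
      by (rule fundamental_theorem_of_calculus[OF _ deriv]) simp
    moreover have "cis (w * (a + 1)) = cis (w * a)"
    proof -
      have "w * (a + 1) = w * a + 2 * pi * of_int k"
        by (simp add: w_def algebra_simps)
      then show ?thesis
        by (simp only: cis_mult[symmetric] cis_multiple_2pi[OF Ints_of_int] mult_1_right)
    qed
    ultimately have "((\<lambda>t. c * cis (w * t)) has_integral 0) {a..a+1}" by simp
    moreover have "(\<lambda>N. c * ((\<Sum>n=1..N. cis (w * u n)) / of_nat N)) \<longlonglongrightarrow> c * 0"
      unfolding w_def by (intro tendsto_intros weyl_sums_vanish_int assms False)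
    ultimately show ?thesis
      unfolding w_def[symmetric] by (auto simp: sum_distrib_left)
  qed
next
  case (add f g)
  then obtain I J where "(f has_integral I) {a..a+1}" "(\<lambda>N. (\<Sum>n=1..N. f (u n)) / of_nat N) \<longlonglongrightarrow> I"
    "(g has_integral J) {a..a+1}" "(\<lambda>N. (\<Sum>n=1..N. g (u n)) / of_nat N) \<longlonglongrightarrow> J" by blast
  then have "((\<lambda>t. f t + g t) has_integral (I + J)) {a..a+1}"
    "(\<lambda>N. (\<Sum>n=1..N. f (u n) + g (u n)) / of_nat N) \<longlonglongrightarrow> I + J"
    by (auto intro: has_integral_add dest: tendsto_add simp: sum.distrib add_divide_distrib)
  then show ?case by blast
qed

text \<open>An argument with three errors of \<open>e / 3\<close>: replacing \<open>F\<close> by a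
  uniformly close polynomial in the mean, the same in the integral, and the convergence of the
  polynomial means.\<close>

lemma mean_continuous_on_circle:
  fixes F :: "complex \<Rightarrow> real"
  assumes u: "weyl_sums_vanish u" and F: "continuous_on (sphere 0 1) F"
  shows "(\<lambda>N. (\<Sum>n=1..N. F (cis (2 * pi * u n))) / real N) \<longlonglongrightarrow> integral {a..a+1} (\<lambda>t. F (cis (2 * pi * t)))"
proof (rule LIMSEQ_I)
  fix e :: real assume e: "e > 0"
  define I where "I = integral {a..a+1} (\<lambda>t. F (cis (2 * pi * t)))"
  obtain p where p: "real_polynomial_function p" and Fp: "\<And>z. z \<in> sphere 0 1 \<Longrightarrow> \<bar>F z - p z\<bar> < e / 3"
    using Stone_Weierstrass_real_polynomial_function[OF compact_sphere F, of "e / 3"] e by auto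
  have Fp': "\<bar>F (cis t) - p (cis t)\<bar> < e / 3" for t by (rule Fp) simp
  obtain K where K: "((\<lambda>t. complex_of_real (p (cis (2 * pi * t)))) has_integral K) {a..a+1}"
     and limK: "(\<lambda>N. (\<Sum>n=1..N. complex_of_real (p (cis (2 * pi * u n)))) / of_nat N) \<longlonglongrightarrow> K"
    using mean_trig_polynomial[OF trig_polynomial_real_polynomial_function[OF p] u] by blast
  have Kr: "((\<lambda>t. p (cis (2 * pi * t))) has_integral Re K) {a..a+1}"
    using has_integral_linear[OF K bounded_linear_Re] by (simp add: o_def)
  have limR: "(\<lambda>N. (\<Sum>n=1..N. p (cis (2 * pi * u n))) / real N) \<longlonglongrightarrow> Re K"
    using tendsto_Re[OF limK] by (simp add: Re_divide_of_nat)
  have "continuous_on {a..a+1} (\<lambda>t. F (cis (2 * pi * t)))"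
    by (rule continuous_on_compose2[OF F]) (auto intro!: continuous_intros)
  then have "((\<lambda>t. F (cis (2 * pi * t))) has_integral I) {a..a+1}"
    unfolding I_def by (intro integrable_integral integrable_continuous_real)
  from has_integral_diff[OF this Kr]
  \<comment> \<open>The interval has length 1, so the pointwise error bounds the difference of the
    integrals.\<close>
  have "norm (I - Re K) \<le> e / 3 * measure lborel (cbox a (a+1))"
    by (intro has_integral_bound[where f = "\<lambda>t. F (cis (2 * pi * t)) - p (cis (2 * pi * t))"])
      (use Fp' e in \<open>auto simp: less_imp_le\<close>)
  then have IK: "\<bar>I - Re K\<bar> \<le> e / 3" by simp
  obtain N0 where N0: "\<And>N. N \<ge> N0 \<Longrightarrow> \<bar>(\<Sum>n=1..N. p (cis (2 * pi * u n))) / real N - Re K\<bar> < e / 3"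
    using LIMSEQ_D[OF limR, of "e / 3"] e by auto
  show "\<exists>N0. \<forall>N\<ge>N0. norm ((\<Sum>n=1..N. F (cis (2 * pi * u n))) / real N - I) < e"
  proof (intro exI allI impI)
    fix N assume N: "N \<ge> max N0 1"
    have "norm (\<Sum>n=1..N. F (cis (2 * pi * u n)) - p (cis (2 * pi * u n))) \<le> real (card {1..N}) * (e / 3)"
      by (intro sum_norm_bound) (use Fp' in \<open>simp add: less_imp_le\<close>)
    then have "\<bar>(\<Sum>n=1..N. F (cis (2 * pi * u n))) / real N - (\<Sum>n=1..N. p (cis (2 * pi * u n))) / real N\<bar> \<le> e / 3"
      using N by (simp add: sum_subtractf field_simps flip: diff_divide_distrib)
    then show "norm ((\<Sum>n=1..N. F (cis (2 * pi * u n))) / real N - I) < e"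
      using N0[of N] N IK unfolding real_norm_def by linarith
  qed
qed

section \<open>Frequencies of arcs\<close>

lemma cis_2pi_eq_iff: "cis (2 * pi * s) = cis (2 * pi * t) \<longleftrightarrow> s - t \<in> \<int>"
proof -
  have "cis (2 * pi * s) = cis (2 * pi * t) \<longleftrightarrow> cis (2 * pi * (s - t)) = 1"
    by (simp add: right_diff_distrib flip: cis_divide)
  also have "\<dots> \<longleftrightarrow> cos (2 * pi * (s - t)) = 1"
  proof
    assume "cos (2 * pi * (s - t)) = 1"
    moreover from this have "sin (2 * pi * (s - t)) = 0" 
      using sin_cos_squared_add[of "2 * pi * (s - t)"] by simp
    ultimately show "cis (2 * pi * (s - t)) = 1" by (simp add: complex_eq_iff)
  qed (simp add: complex_eq_iff)
  also have "\<dots> \<longleftrightarrow> s - t \<in> \<int>"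
    unfolding cos_one_2pi_int by (auto simp: Ints_def)
  finally show ?thesis .
qed

text \<open>The union of all integer translates of \<open>I\<close>, that is, the preimage in the
  reals of the arc \<open>to_torus\<close> applied to \<open>I\<close>. It lets arcs be handled
  without the quotient type.\<close>

definition mod1_hull :: "real set \<Rightarrow> real set" where
  "mod1_hull I = {t. \<exists>z\<in>I. t - z \<in> \<int>}"

lemma visits_mono: "S \<subseteq> T \<Longrightarrow> visits u S N \<le> visits u T N"
  unfolding visits_def by (intro card_mono) auto

text \<open>The indicator of the closed arc is the decreasing limit of the continuous functions
  \<open>max 0 (1 - m * dist)\<close>.\<close>

lemma frequency_closed_arc_less:
  assumes u: "weyl_sums_vanish u" and ab: "a \<le> b" "b \<le> a + 1" and e: "e > 0"
  shows "\<forall>\<^sub>F N in sequentially. real (visits u (mod1_hull {a..b}) N) / real N < b - a + e"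
proof -
  define A where "A = (\<lambda>t. cis (2 * pi * t)) ` {a..b}"
  have "compact A"
    unfolding A_def by (intro compact_continuous_image continuous_intros) auto
  then have A: "closed A" "A \<noteq> {}"
    using ab by (auto simp: A_def compact_imp_closed)
  define F where "F m z = max 0 (1 - real m * infdist z A)" for m z
  have contF: "continuous_on S (F m)" for m S
    unfolding F_def by (intro continuous_intros)
  have mem_A: "cis (2 * pi * t) \<in> A \<longleftrightarrow> t \<in> mod1_hull {a..b}" for t
    by (auto simp: A_def mod1_hull_def cis_2pi_eq_iff)
  \<comment> \<open>Within one period the hull of the closed arc adds at most the point
    \<open>a + 1\<close>, a null set that does not affect the integral of the indicator.\<close>
  have memA: "t \<in> {a..b} \<or> t = a + 1" if t: "t \<in> {a..a+1}" "cis (2 * pi * t) \<in> A" for t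
  proof -
    obtain s where s: "s \<in> {a..b}" "t - s \<in> \<int>" using t(2) by (auto simp: mem_A mod1_hull_def)
    then obtain i where "t - s = of_int i" by (auto elim: Ints_cases)
    moreover have "\<bar>t - s\<bar> \<le> 1" using s(1) t(1) ab by auto
    ultimately have "i = 0 \<or> i = 1 \<or> i = -1" by linarith
    then show ?thesis using \<open>t - s = of_int i\<close> s(1) t(1) ab by auto
  qed
  have lim: "(\<lambda>m. F m z) \<longlonglongrightarrow> indicator A z" for z
  proof (cases "z \<in> A")
    case True then show ?thesis by (simp add: F_def)
  next
    case False
    \<comment> \<open>Closedness separates \<open>z\<close> from \<open>A\<close>, so
      \<open>F m z\<close> is 0 as soon as \<open>m\<close> exceeds the reciprocal of the
      distance.\<close>
    then have d: "infdist z A > 0"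
      using A by (simp add: infdist_pos_not_in_closed)
    obtain m0 :: nat where "real m0 > 1 / infdist z A" using reals_Archimedean2 by blast
    then have "F m z = 0" if "m \<ge> m0" for m
    proof -
      have "1 / infdist z A < real m" using that \<open>real m0 > 1 / infdist z A\<close> by linarith
      then show ?thesis using d by (simp add: F_def field_simps)
    qed
    then show ?thesis using False
      by (intro tendsto_eventually) (auto simp: eventually_sequentially)
  qed
  have intF: "(\<lambda>t. F m (cis (2 * pi * t))) integrable_on {a..a+1}" for m
    by (intro integrable_continuous_real continuous_on_compose2[OF contF[of UNIV]] continuous_intros) auto
  have ind: "((\<lambda>t. indicator A (cis (2 * pi * t)) :: real) has_integral (b - a)) {a..a+1}"
  proof -
    have "((\<lambda>t. 1 :: real) has_integral (b - a)) {a..b}"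
      using has_integral_const_real[of "1::real" a b] ab by simp
    then have "((\<lambda>t. if t \<in> {a..b} then 1 else 0 :: real) has_integral (b - a)) {a..a+1}"
      by (subst has_integral_restrict) (use ab in auto)
    then show ?thesis
    proof (rule has_integral_spike_finite[of "{a+1}", rotated 2])
      fix t assume "t \<in> {a..a+1} - {a+1}"
      then show "indicator A (cis (2 * pi * t)) = (if t \<in> {a..b} then 1 else 0 :: real)"
        using memA[of t] by (auto simp: A_def indicator_def)
    qed simp
  qed
  have "(\<lambda>m. integral {a..a+1} (\<lambda>t. F m (cis (2 * pi * t)))) \<longlonglongrightarrow>
      integral {a..a+1} (\<lambda>t. indicator A (cis (2 * pi * t)))"
  proof (rule dominated_convergence(2)[OF intF])
    show "(\<lambda>t. 1 :: real) integrable_on {a..a+1}" by (rule integrable_const_ivl)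
    show "norm (F m (cis (2 * pi * t))) \<le> 1" for m t
      using infdist_nonneg[of "cis (2 * pi * t)" A] by (simp add: F_def)
  qed (rule lim)
  then have "(\<lambda>m. integral {a..a+1} (\<lambda>t. F m (cis (2 * pi * t)))) \<longlonglongrightarrow> b - a"
    by (simp add: integral_unique[OF ind])
  then have "\<forall>\<^sub>F m in sequentially. integral {a..a+1} (\<lambda>t. F m (cis (2 * pi * t))) < b - a + e"
    by (rule order_tendstoD) (use e in simp)
  then obtain m where m: "integral {a..a+1} (\<lambda>t. F m (cis (2 * pi * t))) < b - a + e"
    using eventually_happens'[OF sequentially_bot] by blast
  have "\<forall>\<^sub>F N in sequentially. (\<Sum>n=1..N. F m (cis (2 * pi * u n))) / real N < b - a + e"
    by (rule order_tendstoD(2)[OF mean_continuous_on_circle[OF u contF] m])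
  then show ?thesis
  proof eventually_elim
    case (elim N)
    have "real (visits u (mod1_hull {a..b}) N) = (\<Sum>n=1..N. indicator A (cis (2 * pi * u n)))"
      by (auto simp: visits_def indicator_def mem_A simp flip: sum.inter_filter
        intro!: arg_cong[where f = card])
    \<comment> \<open>\<open>F m\<close> equals 1 on \<open>A\<close> and is nonnegative elsewhere,
      so it dominates the indicator.\<close>
    also have "\<dots> \<le> (\<Sum>n=1..N. F m (cis (2 * pi * u n)))"
      by (intro sum_mono) (simp add: F_def indicator_def)
    finally show ?case using elim
      by (meson divide_right_mono le_less_trans of_nat_0_le_iff)
  qed
qed

text \<open>Each real has a representative \<open>s\<close> in \<open>{a..<a+1}\<close>. Outside the
  open arc it lies in \<open>{b..a+1}\<close> or equals \<open>a\<close>, and then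
  \<open>a + 1\<close> represents the same point.\<close>

lemma mod1_hull_complement:
  assumes "a \<le> b" "b \<le> a + 1" "{a<..<b} \<subseteq> I"
  shows "- mod1_hull I \<subseteq> mod1_hull {b..a+1}"
proof
  fix t assume t: "t \<in> - mod1_hull I"
  define s where "s = a + frac (t - a)"
  have ts: "t - s \<in> \<int>" by (simp add: s_def frac_def)
  have s: "a \<le> s" "s < a + 1" by (auto simp: s_def frac_ge_0 frac_lt_1)
  have "s \<notin> {a<..<b}" using t ts assms(3) by (auto simp: mod1_hull_def)
  then consider "b \<le> s" | "s = a" using s by fastforce
  then show "t \<in> mod1_hull {b..a+1}"
  proof cases
    case 1 then show ?thesis using ts s by (auto simp: mod1_hull_def)
  next
    case 2
    have "t - (a + 1) \<in> \<int>" using Ints_diff[OF ts Ints_1] 2 by (simp add: algebra_simps)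
    then show ?thesis using assms(2) by (auto simp: mod1_hull_def)
  qed
qed

text \<open>Enclosing \<open>I\<close> between the open and the closed arc covers every choice of
  endpoints. The closed arc bounds the frequency from above; \<open>{b..a+1}\<close>, of length
  \<open>1 - (b - a)\<close>, covers the complement and bounds it from below.\<close>

lemma frequency_arc_tendsto:
  assumes u: "weyl_sums_vanish u" and ab: "a \<le> b" "b \<le> a + 1"
    and I: "{a<..<b} \<subseteq> I" "I \<subseteq> {a..b}"
  shows "(\<lambda>N. real (visits u (mod1_hull I) N) / real N) \<longlonglongrightarrow> b - a"
proof (rule LIMSEQ_I)
  fix e :: real assume e: "e > 0"
  have "\<forall>\<^sub>F N in sequentially. norm (real (visits u (mod1_hull I) N) / real N - (b - a)) < e"
    using frequency_closed_arc_less[OF u ab e]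
      frequency_closed_arc_less[OF u ab(2) add_right_mono[OF ab(1)] e] eventually_gt_at_top[of 0]
  proof eventually_elim
    case (elim N)
    have "visits u (mod1_hull I) N \<le> visits u (mod1_hull {a..b}) N"
      using I(2) by (intro visits_mono) (auto simp: mod1_hull_def)
    then have "real (visits u (mod1_hull I) N) / real N \<le> real (visits u (mod1_hull {a..b}) N) / real N"
      by (intro divide_right_mono) auto
    moreover have "N \<le> visits u (mod1_hull I) N + visits u (mod1_hull {b..a+1}) N"
    proof -
      have "card {1..N} \<le> card ({i\<in>{1..N}. u i \<in> mod1_hull I} \<union> {i\<in>{1..N}. u i \<in> mod1_hull {b..a+1}})"
        using mod1_hull_complement[OF ab I(1)] by (intro card_mono) auto
      also have "\<dots> \<le> visits u (mod1_hull I) N + visits u (mod1_hull {b..a+1}) N"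
        unfolding visits_def by (rule card_Un_le)
      finally show ?thesis by simp
    qed
    then have "real N / real N \<le> (real (visits u (mod1_hull I) N) + real (visits u (mod1_hull {b..a+1}) N)) / real N"
      by (intro divide_right_mono) linarith+
    ultimately show ?case
      using elim by (simp add: add_divide_distrib)
  qed
  then show "\<exists>N0. \<forall>N\<ge>N0. norm (real (visits u (mod1_hull I) N) / real N - (b - a)) < e"
    by (simp add: eventually_sequentially)
qed

section \<open>Uniform distribution makes Weyl sums vanish\<close>

text \<open>A chord is no longer than its arc: its length is twice the absolute sine of half the
  angle.\<close>

lemma norm_cis_diff_le: "cmod (cis a - cis b) \<le> \<bar>a - b\<bar>"
proof -
  have "cis a - cis b = cis b * (exp (\<i> * of_real (a - b)) - 1)"
    by (simp add: cis_conv_exp algebra_simps exp_diff)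
  then have "cmod (cis a - cis b) = 2 * \<bar>sin ((a - b) / 2)\<bar>"
    by (simp only: norm_mult norm_cis dist_exp_i_1 mult_1_left)
  also have "\<dots> \<le> \<bar>a - b\<bar>"
    using abs_sin_x_le_abs_x[of "(a - b) / 2"] by simp
  finally show ?thesis .
qed

text \<open>A geometric sum whose ratio is an \<open>M\<close>-th root of unity, different from 1
  because \<open>0 < k < M\<close>.\<close>

lemma sum_cis_equally_spaced:
  assumes "0 < k" "k < M"
  shows "(\<Sum>j<M. cis (2 * pi * real k * (real j / real M))) = 0"
proof -
  define z where "z = cis (2 * pi * real k / real M)"
  have "2 * pi * real k / real M < 2 * pi"
    using assms by (simp add: field_simps)
  then have "z \<noteq> 1"
    using exp_i_ne_1[of "2 * pi * real k / real M"] assms by (simp add: z_def cis_conv_exp)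
  moreover have "z ^ M = 1"
  proof -
    have "real M * (2 * pi * real k / real M) = 2 * pi * real k"
      using assms by simp
    then show ?thesis
      by (simp only: z_def Complex.DeMoivre cis_multiple_2pi[OF Ints_of_nat])
  qed
  moreover have "(\<Sum>j<M. cis (2 * pi * real k * (real j / real M))) = (\<Sum>j<M. z ^ j)"
    by (simp add: z_def Complex.DeMoivre mult_ac)
  ultimately show ?thesis by (simp add: geometric_sum)
qed

lemma cis_frac: "cis (2 * pi * real k * frac t) = cis (2 * pi * real k * t)"
proof -
  have "2 * pi * real k * t = 2 * pi * real k * frac t + 2 * pi * of_int (int k * \<lfloor>t\<rfloor>)"
    by (simp add: frac_def algebra_simps)
  then show ?thesis
    by (simp only: cis_mult[symmetric] cis_multiple_2pi[OF Ints_of_int] mult_1_right)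
qed

text \<open>Moving each point to the left end of its cell changes the Weyl mean by at most
  \<open>2 * pi * k / M\<close>. The new mean is a fixed combination of cell frequencies and tends
  to an average over \<open>M\<close>-th roots of unity, which is 0. Both settings supply the
  hypothesis.\<close>

lemma weyl_sums_vanish_if_cells:
  assumes cells: "\<And>M j. j < M \<Longrightarrow>
    (\<lambda>N. real (visits u {t. frac t \<in> {real j / real M..<real (Suc j) / real M}} N) / real N) \<longlonglongrightarrow> 1 / real M"
  shows "weyl_sums_vanish u"
  unfolding weyl_sums_vanish_def
proof (intro allI impI)
  fix k :: nat assume k: "k > 0"
  show "(\<lambda>N. (\<Sum>n=1..N. cis (2 * pi * real k * u n)) / of_nat N) \<longlonglongrightarrow> 0"
  proof (rule LIMSEQ_I)
    fix e :: real assume e: "e > 0"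
    \<comment> \<open>The bound \<open>k < M\<close> makes the geometric sum vanish; the other bound
      keeps the discretisation error below \<open>e / 2\<close>.\<close>
    obtain M :: nat where "M > max (real k) (4 * pi * real k / e)"
      using reals_Archimedean2 by blast
    then have M: "k < M" and Me: "4 * pi * real k / e < real M" by auto
    have M0: "real M > 0" using M by simp
    have Me': "2 * pi * real k / real M < e / 2"
      using Me e M0 by (simp add: field_simps)
    \<comment> \<open>\<open>J n\<close> is the index of the cell that contains the fractional part
      of \<open>u n\<close>.\<close>
    define J where "J n = nat \<lfloor>real M * frac (u n)\<rfloor>" for n
    have Jle: "real (J n) \<le> real M * frac (u n)" "real M * frac (u n) < real (Suc (J n))" for n
    proof -
      have "real M * frac (u n) \<ge> 0" by (simp add: frac_ge_0)
      then show "real (J n) \<le> real M * frac (u n)" "real M * frac (u n) < real (Suc (J n))"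
        unfolding J_def by linarith+
    qed
    have Jlt: "J n < M" for n
    proof -
      have "real M * frac (u n) < real M * 1"
        using frac_lt_1[of "u n"] M0 by (intro mult_strict_left_mono)
      then show ?thesis using Jle(1)[of n] by simp
    qed
    have Jeq: "J n = j \<longleftrightarrow> frac (u n) \<in> {real j / real M..<real (Suc j) / real M}" for n j
    proof
      show "J n = j \<Longrightarrow> frac (u n) \<in> {real j / real M..<real (Suc j) / real M}"
        using Jle[of n] M0 by (auto simp: field_simps)
      assume "frac (u n) \<in> {real j / real M..<real (Suc j) / real M}"
      then have "real j \<le> real M * frac (u n)" "real M * frac (u n) < real (Suc j)"
        using M0 by (auto simp: field_simps)
      then show "J n = j" using Jle[of n] by linarith
    qed
    define S where "S N = (\<Sum>n=1..N. cis (2 * pi * real k * (real (J n) / real M)))" for N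
    have S: "S N = (\<Sum>j<M. of_nat (visits u {t. frac t \<in> {real j / real M..<real (Suc j) / real M}} N)
          * cis (2 * pi * real k * (real j / real M)))" for N
    proof -
      \<comment> \<open>Grouping the indices by cell turns the sum into visit counts.\<close>
      have "S N = (\<Sum>j<M. \<Sum>n\<in>{n\<in>{1..N}. J n = j}. cis (2 * pi * real k * (real (J n) / real M)))"
        unfolding S_def by (rule sum.group[symmetric]) (use Jlt in auto)
      also have "\<dots> = (\<Sum>j<M. of_nat (card {n\<in>{1..N}. J n = j}) * cis (2 * pi * real k * (real j / real M)))"
        by (intro sum.cong refl) simp
      finally show ?thesis by (simp only: visits_def Jeq mem_Collect_eq)
    qed
    have "(\<lambda>N. \<Sum>j<M. of_real (real (visits u {t. frac t \<in> {real j / real M..<real (Suc j) / real M}} N) / real N)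
          * cis (2 * pi * real k * (real j / real M)))
        \<longlonglongrightarrow> (\<Sum>j<M. of_real (1 / real M) * cis (2 * pi * real k * (real j / real M)))"
      by (intro tendsto_intros cells) simp
    also have "(\<Sum>j<M. of_real (1 / real M) * cis (2 * pi * real k * (real j / real M))) = 0"
      by (simp only: sum_distrib_left[symmetric] sum_cis_equally_spaced[OF k M] mult_zero_right)
    finally have "(\<lambda>N. S N / of_nat N) \<longlonglongrightarrow> 0"
      by (simp only: S sum_divide_distrib of_real_divide of_real_of_nat_eq times_divide_eq_left)
    then obtain N0 where N0: "\<And>N. N \<ge> N0 \<Longrightarrow> cmod (S N / of_nat N) < e / 2"
      using LIMSEQ_D[of _ 0 "e / 2"] e by auto
    show "\<exists>N0. \<forall>N\<ge>N0. norm ((\<Sum>n=1..N. cis (2 * pi * real k * u n)) / of_nat N - 0) < e"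
    proof (intro exI allI impI)
      fix N assume N: "N \<ge> max N0 1"
      have "cmod (cis (2 * pi * real k * u n) - cis (2 * pi * real k * (real (J n) / real M)))
          \<le> 2 * pi * real k / real M" for n
      proof -
        have "cmod (cis (2 * pi * real k * u n) - cis (2 * pi * real k * (real (J n) / real M)))
          \<le> \<bar>2 * pi * real k * frac (u n) - 2 * pi * real k * (real (J n) / real M)\<bar>"
          unfolding cis_frac[symmetric, of k "u n"] by (rule norm_cis_diff_le)
        also have "\<dots> = \<bar>2 * pi * real k\<bar> * \<bar>frac (u n) - real (J n) / real M\<bar>"
          by (simp only: right_diff_distrib[symmetric] abs_mult)
        also have "\<dots> = 2 * pi * real k * \<bar>frac (u n) - real (J n) / real M\<bar>"
          by simp
        also have "\<dots> \<le> 2 * pi * real k * (1 / real M)"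
        proof (intro mult_left_mono)
          have "frac (u n) - real (J n) / real M = (real M * frac (u n) - real (J n)) / real M"
            using M0 by (simp add: field_simps)
          also have "\<bar>\<dots>\<bar> \<le> 1 / real M"
            using Jle[of n] M0 by (auto simp: abs_divide intro!: divide_right_mono)
          finally show "\<bar>frac (u n) - real (J n) / real M\<bar> \<le> 1 / real M" .
        qed simp
        finally show ?thesis by simp
      qed
      then have "cmod (\<Sum>n=1..N. cis (2 * pi * real k * u n) - cis (2 * pi * real k * (real (J n) / real M)))
          \<le> real (card {1..N}) * (2 * pi * real k / real M)"
        by (intro sum_norm_bound) auto
      then have "cmod ((\<Sum>n=1..N. cis (2 * pi * real k * u n)) - S N) \<le> real N * (2 * pi * real k / real M)"
        by (simp add: S_def sum_subtractf)
      then have "cmod ((\<Sum>n=1..N. cis (2 * pi * real k * u n)) / of_nat N - S N / of_nat N) \<le> 2 * pi * real k / real M"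
        using N by (simp add: norm_divide field_simps flip: diff_divide_distrib)
      then show "norm ((\<Sum>n=1..N. cis (2 * pi * real k * u n)) / of_nat N - 0) < e"
        using N0[of N] N Me'
          norm_triangle_sub[of "(\<Sum>n=1..N. cis (2 * pi * real k * u n)) / of_nat N" "S N / of_nat N"]
        by simp
    qed
  qed
qed

section \<open>Arcs, the torus and the unit interval\<close>

text \<open>The endpoints are the infimum and supremum. The measure is squeezed between those of the
  open and the closed interval.\<close>

lemma is_interval_real_bounds:
  fixes I :: "real set"
  assumes "is_interval I" "bounded I" "I \<noteq> {}"
  obtains a b where "a \<le> b" "{a<..<b} \<subseteq> I" "I \<subseteq> {a..b}" "measure lborel I = b - a"
proof -
  define a where "a = Inf I"
  define b where "b = Sup I"
  have bdd: "bdd_above I" "bdd_below I"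
    using assms(2) by (simp_all add: bounded_imp_bdd_above bounded_imp_bdd_below)
  have sub: "I \<subseteq> {a..b}"
    using bdd by (auto simp: a_def b_def intro: cInf_lower cSup_upper)
  have sup: "{a<..<b} \<subseteq> I"
  proof
    fix t assume "t \<in> {a<..<b}"
    then obtain p q where "p \<in> I" "p < t" "q \<in> I" "t < q"
      using assms(3) bdd by (auto simp: a_def b_def cInf_less_iff less_cSup_iff)
    then show "t \<in> I" using assms(1) by (meson is_interval_1 less_imp_le)
  qed
  have ab: "a \<le> b" using sub assms(3) by force
  \<comment> \<open>An open set together with finitely many points is Borel, which the lower bound
    on the measure requires.\<close>
  have "I = {a<..<b} \<union> (I \<inter> {a, b})"
    using sub sup by (auto simp: le_less)
  moreover have "finite (I \<inter> {a, b})" by simp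
  ultimately have "I \<in> sets lborel"
    by (metis borel_open finite_imp_closed borel_closed open_greaterThanLessThan sets.Un sets_lborel)
  moreover have "emeasure lborel I = ennreal (b - a)"
  proof (rule antisym)
    show "emeasure lborel I \<le> ennreal (b - a)"
      using emeasure_mono[OF sub, of lborel] ab by simp
    show "ennreal (b - a) \<le> emeasure lborel I"
      using emeasure_mono[OF sup \<open>I \<in> sets lborel\<close>] ab by simp
  qed
  ultimately have "measure lborel I = b - a"
    using ab by (simp add: measure_def)
  with ab sub sup show thesis using that by blast
qed

section \<open>Hulls, cells and the quotient map\<close>

lemma subset_mod1_hull: "I \<subseteq> mod1_hull I"
proof
  fix t assume "t \<in> I"
  moreover have "t - t \<in> \<int>" by simp
  ultimately show "t \<in> mod1_hull I" unfolding mod1_hull_def by blast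
qed

text \<open>A real has exactly one representative modulo 1 in \<open>{0..<1}\<close>, namely its
  fractional part.\<close>

lemma mod1_hull_eq_frac:
  assumes "I \<subseteq> {0..<1}"
  shows "mod1_hull I = {t. frac t \<in> I}"
proof (intro set_eqI iffI)
  fix t assume "t \<in> mod1_hull I"
  then obtain z where z: "z \<in> I" "t - z \<in> \<int>" by (auto simp: mod1_hull_def)
  then have "frac t = z" using assms by (auto simp: frac_unique_iff)
  with z show "t \<in> {t. frac t \<in> I}" by simp
next
  fix t assume "t \<in> {t. frac t \<in> I}"
  moreover have "t - frac t \<in> \<int>" by (simp add: frac_def)
  ultimately show "t \<in> mod1_hull I" by (auto simp: mod1_hull_def)
qed

lemma cell_subset_unit_interval:
  assumes "j < M"
  shows "{real j / real M..<real (Suc j) / real M} \<subseteq> {0..<1}"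
proof -
  have "real (Suc j) / real M \<le> 1" using assms by simp
  then show ?thesis by (auto intro: order_trans[rotated] simp del: of_nat_Suc)
qed

lemma measure_cell: "measure lborel {real j / real M..<real (Suc j) / real M} = 1 / real M"
  by (simp add: divide_right_mono add_divide_distrib)

lemma to_torus_eq_iff: "to_torus a = to_torus b \<longleftrightarrow> a - b \<in> \<int>"
  by transfer simp

lemma to_torus_surj: "\<exists>r. y = to_torus r"
  by transfer (metis Ints_0 diff_self)

lemma torus_theta_to_torus: "torus_theta t (to_torus a - to_torus b) = jacobi_theta t (a - b)"
  by transfer simp

lemma visits_to_torus_image: "visits (\<lambda>n. to_torus (u n)) (to_torus ` I) N = visits u (mod1_hull I) N"
  unfolding visits_def mod1_hull_def by (simp add: image_iff to_torus_eq_iff)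

text \<open>One direction tests only the half-open cells; the other applies the arc limit to the
  endpoints of an arbitrary nonempty \<open>I\<close>.\<close>

theorem uniformly_distributed_torus_iff_weyl:
  "uniformly_distributed_torus (\<lambda>n. to_torus (u n)) \<longleftrightarrow> weyl_sums_vanish u"
proof
  assume ud: "uniformly_distributed_torus (\<lambda>n. to_torus (u n))"
  show "weyl_sums_vanish u"
  proof (rule weyl_sums_vanish_if_cells)
    fix M j :: nat assume j: "j < M"
    let ?I = "{real j / real M..<real (Suc j) / real M}"
    have "is_interval ?I \<and> bounded ?I \<and> measure lborel ?I \<le> 1"
      using j unfolding measure_cell by (simp add: is_interval_co)
    then have "(\<lambda>N. real (visits u (mod1_hull ?I) N) / real N) \<longlonglongrightarrow> measure lborel ?I"
      using ud unfolding uniformly_distributed_torus_def visits_to_torus_image by blast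
    then show "(\<lambda>N. real (visits u {t. frac t \<in> ?I} N) / real N) \<longlonglongrightarrow> 1 / real M"
      unfolding measure_cell mod1_hull_eq_frac[OF cell_subset_unit_interval[OF j]] .
  qed
next
  assume u: "weyl_sums_vanish u"
  show "uniformly_distributed_torus (\<lambda>n. to_torus (u n))"
    unfolding uniformly_distributed_torus_def visits_to_torus_image
  proof (intro allI impI)
    fix I :: "real set" assume I: "is_interval I \<and> bounded I \<and> measure lborel I \<le> 1"
    show "(\<lambda>N. real (visits u (mod1_hull I) N) / real N) \<longlonglongrightarrow> measure lborel I"
    proof (cases "I = {}")
      case True
      then show ?thesis by (simp add: visits_def mod1_hull_def)
    next
      case False
      then obtain a b where "a \<le> b" "{a<..<b} \<subseteq> I" "I \<subseteq> {a..b}" "measure lborel I = b - a"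
        using is_interval_real_bounds I by metis
      then show ?thesis using frequency_arc_tendsto[OF u, of a b I] I by simp
    qed
  qed
qed

text \<open>Two distinct points of \<open>{0..1}\<close> agree modulo 1 only if they are 0 and 1.
  Passing to the hull thus adds at most visits to these endpoints, whose frequency tends to 0 by
  \<open>ends\<close>.\<close>

lemma frequency_mod1_hull_iff:
  assumes x: "\<And>n. n \<ge> 1 \<Longrightarrow> x n \<in> {0..1}" and J: "J \<subseteq> {0..1}"
    and ends: "(\<lambda>N. real (visits x {0,1} N) / real N) \<longlonglongrightarrow> 0"
  shows "(\<lambda>N. real (visits x (mod1_hull J) N) / real N) \<longlonglongrightarrow> c
    \<longleftrightarrow> (\<lambda>N. real (visits x J N) / real N) \<longlonglongrightarrow> c"
proof -
  have le: "visits x J N \<le> visits x (mod1_hull J) N" for N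
    by (rule visits_mono) (rule subset_mod1_hull)
  have sub: "t \<in> J \<or> t \<in> {0,1}" if t: "t \<in> {0..1}" "t \<in> mod1_hull J" for t
  proof -
    obtain z where z: "z \<in> J" "t - z \<in> \<int>" using t(2) by (auto simp: mod1_hull_def)
    then obtain i where i: "t - z = of_int i" by (auto elim: Ints_cases)
    have z01: "z \<in> {0..1}" using J z by auto
    then have "\<bar>t - z\<bar> \<le> 1" using t(1) by auto
    then have "i = 0 \<or> i = 1 \<or> i = -1" using i by linarith
    then show ?thesis using i z z01 t(1) by auto
  qed
  have ge: "visits x (mod1_hull J) N \<le> visits x J N + visits x {0,1} N" for N
  proof -
    have "visits x (mod1_hull J) N \<le> card ({i\<in>{1..N}. x i \<in> J} \<union> {i\<in>{1..N}. x i \<in> {0,1}})"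
      unfolding visits_def using sub x by (intro card_mono) auto
    also have "\<dots> \<le> visits x J N + visits x {0,1} N"
      unfolding visits_def by (rule card_Un_le)
    finally show ?thesis .
  qed
  have "(\<lambda>N. real (visits x (mod1_hull J) N) / real N - real (visits x J N) / real N) \<longlonglongrightarrow> 0"
  proof (rule tendsto_sandwich[OF always_eventually always_eventually tendsto_const ends]; intro allI)
    fix N
    show "0 \<le> real (visits x (mod1_hull J) N) / real N - real (visits x J N) / real N"
      using le[of N] by (simp add: divide_right_mono)
    have "real (visits x (mod1_hull J) N) / real N \<le> (real (visits x J N) + real (visits x {0,1} N)) / real N"
      using ge[of N] by (intro divide_right_mono) linarith+
    then show "real (visits x (mod1_hull J) N) / real N - real (visits x J N) / real N
        \<le> real (visits x {0,1} N) / real N"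
      by (simp add: add_divide_distrib)
  qed
  then show ?thesis
    by (rule Lim_transform_eq)
qed

text \<open>Each direction first shows that the endpoints have frequency 0, and then intervals and
  arcs may be exchanged.\<close>

theorem uniformly_distributed_interval_iff_weyl:
  assumes x: "\<And>n. n \<ge> 1 \<Longrightarrow> x n \<in> {0..1}"
  shows "uniformly_distributed_interval x \<longleftrightarrow> weyl_sums_vanish x"
proof
  assume ud: "uniformly_distributed_interval x"
  have freq: "(\<lambda>N. real (visits x J N) / real N) \<longlonglongrightarrow> measure lborel J"
    if "is_interval J" "J \<subseteq> {0..1}" for J
    using ud that unfolding uniformly_distributed_interval_def by blast
  \<comment> \<open>A point is a degenerate interval of length 0.\<close>
  have single: "(\<lambda>N. real (visits x {p} N) / real N) \<longlonglongrightarrow> 0" if "p \<in> {0..1}" for p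
    using freq[of "{p}"] that by (simp add: measure_def is_interval_1)
  have "visits x {0,1} N = visits x {0} N + visits x {1} N" for N
  proof -
    have "visits x {0,1} N = card ({i\<in>{1..N}. x i \<in> {0}} \<union> {i\<in>{1..N}. x i \<in> {1}})"
      unfolding visits_def by (rule arg_cong[where f = card]) auto
    also have "\<dots> = visits x {0} N + visits x {1} N"
      unfolding visits_def by (rule card_Un_disjoint) auto
    finally show ?thesis .
  qed
  then have ends: "(\<lambda>N. real (visits x {0,1} N) / real N) \<longlonglongrightarrow> 0"
    using tendsto_add[OF single[of 0] single[of 1]] by (simp add: add_divide_distrib)
  show "weyl_sums_vanish x"
  proof (rule weyl_sums_vanish_if_cells)
    fix M j :: nat assume j: "j < M"
    let ?I = "{real j / real M..<real (Suc j) / real M}"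
    have I: "?I \<subseteq> {0..<1}" by (rule cell_subset_unit_interval[OF j])
    then have I': "?I \<subseteq> {0..1}" by fastforce
    have "(\<lambda>N. real (visits x ?I N) / real N) \<longlonglongrightarrow> measure lborel ?I"
      by (rule freq[OF is_interval_co I'])
    then have "(\<lambda>N. real (visits x (mod1_hull ?I) N) / real N) \<longlonglongrightarrow> measure lborel ?I"
      by (subst frequency_mod1_hull_iff[OF x I' ends])
    then show "(\<lambda>N. real (visits x {t. frac t \<in> ?I} N) / real N) \<longlonglongrightarrow> 1 / real M"
      unfolding measure_cell mod1_hull_eq_frac[OF I] .
  qed
next
  assume u: "weyl_sums_vanish x"
  have ends: "(\<lambda>N. real (visits x {0,1} N) / real N) \<longlonglongrightarrow> 0"
  proof -
    \<comment> \<open>The hull of \<open>{0}\<close> consists of the integers, so this one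
      degenerate arc accounts for both 0 and 1.\<close>
    have lim: "(\<lambda>N. real (visits x (mod1_hull {0}) N) / real N) \<longlonglongrightarrow> 0"
      using frequency_arc_tendsto[OF u, of 0 0 "{0}"] by simp
    have "real (visits x {0,1} N) / real N \<le> real (visits x (mod1_hull {0}) N) / real N" for N
      by (intro divide_right_mono of_nat_mono visits_mono) (auto simp: mod1_hull_def)
    then show ?thesis
      by (intro tendsto_sandwich[OF _ _ tendsto_const lim] always_eventually) simp_all
  qed
  show "uniformly_distributed_interval x"
    unfolding uniformly_distributed_interval_def
  proof (intro allI impI)
    fix J :: "real set" assume J: "is_interval J \<and> J \<subseteq> {0..1}"
    show "(\<lambda>N. real (visits x J N) / real N) \<longlonglongrightarrow> measure lborel J"
    proof (cases "J = {}")
      case True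
      then show ?thesis by (simp add: visits_def)
    next
      case False
      have "bounded J" using J bounded_subset[OF bounded_closed_interval] by blast
      with False J obtain a b where ab: "a \<le> b" "{a<..<b} \<subseteq> J" "J \<subseteq> {a..b}" "measure lborel J = b - a"
        using is_interval_real_bounds by metis
      have "{a<..<b} \<subseteq> {0..1}" using ab(2) J by blast
      then have "measure lborel J \<le> 1"
        using ab(1,4) unfolding greaterThanLessThan_subseteq_atLeastAtMost_iff by linarith
      then have "(\<lambda>N. real (visits x (mod1_hull J) N) / real N) \<longlonglongrightarrow> measure lborel J"
        using frequency_arc_tendsto[OF u, of a b J] ab by simp
      then show ?thesis
        using frequency_mod1_hull_iff[OF x _ ends] J by blast
    qed
  qed
qed

theorem corollary2:
  fixes x :: "nat \<Rightarrow> real" and y :: "nat \<Rightarrow> torus"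
  shows "((\<forall>n\<ge>1. x n \<in> {0..1}) \<longrightarrow>
            (uniformly_distributed_interval x \<longleftrightarrow>
              (\<lambda>N. 1 / (real N)\<^sup>2 * (\<Sum>m=1..N. \<Sum>n=1..N. jacobi_theta 1 (x n - x m))) \<longlonglongrightarrow> 1))
       \<and> (uniformly_distributed_torus y \<longleftrightarrow>
            (\<lambda>N. 1 / (real N)\<^sup>2 * (\<Sum>m=1..N. \<Sum>n=1..N. torus_theta 1 (y n - y m))) \<longlonglongrightarrow> 1)"
proof (intro conjI impI)
  assume "\<forall>n\<ge>1. x n \<in> {0..1}"
  then show "uniformly_distributed_interval x \<longleftrightarrow>
      (\<lambda>N. 1 / (real N)\<^sup>2 * (\<Sum>m=1..N. \<Sum>n=1..N. jacobi_theta 1 (x n - x m))) \<longlonglongrightarrow> 1"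
    by (subst theta_energy_tendsto_1_iff) (simp_all add: uniformly_distributed_interval_iff_weyl)
next
  \<comment> \<open>A choice of real representatives reduces the torus case to a real sequence; the
    theta energy is unchanged by periodicity.\<close>
  have "\<forall>n. \<exists>r. y n = to_torus r" by (simp add: to_torus_surj)
  then obtain u where "\<forall>n. y n = to_torus (u n)" by (rule choice[THEN exE])
  then have y: "y = (\<lambda>n. to_torus (u n))" by auto
  show "uniformly_distributed_torus y \<longleftrightarrow>
      (\<lambda>N. 1 / (real N)\<^sup>2 * (\<Sum>m=1..N. \<Sum>n=1..N. torus_theta 1 (y n - y m))) \<longlonglongrightarrow> 1"
    unfolding y torus_theta_to_torus
    by (subst theta_energy_tendsto_1_iff) (simp_all add: uniformly_distributed_torus_iff_weyl)
qed

end
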